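(* Let $n\ge 1$ and let $\boldsymbol{p} > \boldsymbol{0}$ and $\boldsymbol{q} > \boldsymbol{0}$ be $n$-dimensional stochastic vectors. Then the matrices $\overline{U}$ and $\overline{V}$ corresponding to $(\boldsymbol{p},\boldsymbol{q})$ satisfy $\overline{U}\,\overline{V}=I$.
   Context: Inequalities between vectors are entrywise; $\boldsymbol{1}$ is the all-ones vector, $\boldsymbol{0}$ the zero vector, $I$ the $n\times n$ identity matrix. A vector $\boldsymbol{a}\in\mathbb{R}^n$ is stochastic if $\boldsymbol{a}^\top\boldsymbol{1}=1$ and $\boldsymbol{a}\ge\boldsymbol{0}$. Write $[c]^+=\max\{c,0\}$ and $[c]^-=\min\{c,0\}$. The matrices $\overline{U},\overline{V}\in\mathbb{R}^{n\times n}$ corresponding to $(\boldsymbol{p},\boldsymbol{q})$ have entries $$\overline{u}_{ij}=\begin{cases}1-[1-p_i/q_i]^+, & i=j,\\ 0, & i\ne j \text{ and } \boldsymbol{p}=\boldsymbol{q},\\ \dfrac{[1-p_i/q_i]^+\,[p_j-q_j]^+}{\sum_{k=1}^n[p_k-q_k]^+}, & i\neq j\text{ and }\boldsymbol{p}\ne\boldsymbol{q},\end{cases}$$ $$\overline{v}_{ij}=\begin{cases}1-[1-q_i/p_i]^-, & i=j,\\ 0, & i\ne j \text{ and } \boldsymbol{p}=\boldsymbol{q},\\ \dfrac{[1-q_i/p_i]^-\,[p_j-q_j]^+}{\sum_{k=1}^n[p_k-q_k]^+}, & i\neq j\text{ and }\boldsymbol{p}\ne\boldsymbol{q}.\end{cases}$$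 *)

theory Defs
  imports "HOL-Analysis.Analysis"
begin

(* The vector 1 is the all-ones vector and the order on vectors is entrywise. *)
definition stochastic :: "real ^ 'n \<Rightarrow> bool" where
  "stochastic a \<longleftrightarrow> a \<bullet> (1 :: real ^ 'n) = 1 \<and> 0 \<le> a"

(* The library's strict order on vectors is not entrywise: it only means
   "entrywise less or equal, and different". Hence a separate notion. *)
definition vec_positive :: "real ^ 'n \<Rightarrow> bool" where
  "vec_positive a \<longleftrightarrow> (\<forall>i. 0 < a $ i)"

definition pos_part :: "real \<Rightarrow> real" where
  "pos_part c = max c 0"

(* Signed: the result is nonpositive. *)
definition neg_part :: "real \<Rightarrow> real" where
  "neg_part c = min c 0"

definition U_bar :: "real ^ 'n \<Rightarrow> real ^ 'n \<Rightarrow> real ^ 'n ^ 'n" where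
  "U_bar p q = (\<chi> i j.
     if i = j then 1 - pos_part (1 - p $ i / q $ i)
     else if p = q then 0
     else pos_part (1 - p $ i / q $ i) * pos_part (p $ j - q $ j)
            / (\<Sum>k\<in>UNIV. pos_part (p $ k - q $ k)))"

definition V_bar :: "real ^ 'n \<Rightarrow> real ^ 'n \<Rightarrow> real ^ 'n ^ 'n" where
  "V_bar p q = (\<chi> i j.
     if i = j then 1 - neg_part (1 - q $ i / p $ i)
     else if p = q then 0
     else neg_part (1 - q $ i / p $ i) * pos_part (p $ j - q $ j)
            / (\<Sum>k\<in>UNIV. pos_part (p $ k - q $ k)))"

end

theory Submission
  imports Defs
begin

text \<open>
  Let \<open>w\<close> be the vector of the excesses \<open>[p\<^sub>j - q\<^sub>j]\<^sup>+\<close>, normalised by their sum, and let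
  \<open>a\<^sub>i = [1 - p\<^sub>i/q\<^sub>i]\<^sup>+\<close> and \<open>b\<^sub>i = [1 - q\<^sub>i/p\<^sub>i]\<^sup>-\<close>. The vectors \<open>a\<close> and \<open>b\<close> live on the indices with
  \<open>p\<^sub>i < q\<^sub>i\<close>, whereas \<open>w\<close> lives on those with \<open>p\<^sub>i > q\<^sub>i\<close>. Since \<open>a\<^sub>i w\<^sub>i = b\<^sub>i w\<^sub>i = 0\<close>, a rank-one term
  does not disturb the diagonal, and the two matrices have the common form
  \<open>U = I - diag a + a w\<^sup>T\<close> and \<open>V = I - diag b + b w\<^sup>T\<close>.

  In the product, \<open>w\<^sup>T diag b\<close> and \<open>w\<^sup>T b\<close> vanish, so that
  \<open>U V = (I - diag a) (I - diag b) + c w\<^sup>T\<close> with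
  \<open>c\<^sub>i = (1 - a\<^sub>i) b\<^sub>i + a\<^sub>i = 1 - (1 - a\<^sub>i) (1 - b\<^sub>i)\<close>. Hence \<open>U V = I\<close> as soon as
  \<open>(1 - a\<^sub>i) (1 - b\<^sub>i) = 1\<close> for all \<open>i\<close>. This is true here: both factors are \<open>1\<close> if \<open>p\<^sub>i \<ge> q\<^sub>i\<close>, and
  they are the reciprocal numbers \<open>p\<^sub>i/q\<^sub>i\<close> and \<open>q\<^sub>i/p\<^sub>i\<close> otherwise.
\<close>

text \<open>
  If the entries of \<open>a\<close> are probabilities and \<open>w\<close> is a distribution, this is the transition matrix of
  the chain that stays at \<open>i\<close> with probability \<open>1 - a\<^sub>i\<close> and otherwise draws its new state from \<open>w\<close>.
\<close>
definition stay_or_redraw :: "real ^ 'n \<Rightarrow> real ^ 'n \<Rightarrow> real ^ 'n ^ 'n" where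
  "stay_or_redraw a w = (\<chi> i j. (if i = j then 1 - a $ i else 0) + a $ i * w $ j)"

text \<open>
  The support condition on \<open>b\<close> expresses that the second factor never moves a state drawn from \<open>w\<close>.
  Therefore the product is again of the same form, with the staying weight
  \<open>(1 - a\<^sub>i) (1 - b\<^sub>i)\<close>, and this weight being \<open>1\<close> everywhere makes it the identity.
\<close>
lemma stay_or_redraw_inverse:
  fixes a b w :: "real ^ 'n"
  assumes reciprocal: "\<And>i. (1 - a $ i) * (1 - b $ i) = 1"
    and disjoint: "\<And>i. b $ i * w $ i = 0"
  shows "stay_or_redraw a w ** stay_or_redraw b w = mat 1"
proof -
  have "(\<Sum>k\<in>UNIV. ((if i = k then 1 - a $ i else 0) + a $ i * w $ k) *
                     ((if k = j then 1 - b $ k else 0) + b $ k * w $ j))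
        = (if i = j then 1 else 0)" (is "?lhs = _") for i j
  proof -
    have redrawn_stays: "w $ k * (1 - b $ k) = w $ k" for k
      using disjoint[of k] by (simp add: algebra_simps)
    have "?lhs = (\<Sum>k\<in>UNIV.
        (if i = k then (if i = j then (1 - a $ i) * (1 - b $ i) else 0)
                       + (1 - a $ i) * b $ i * w $ j else 0)
        + (if k = j then a $ i * (w $ k * (1 - b $ k)) else 0)
        + a $ i * (b $ k * w $ k) * w $ j)"
      by (rule sum.cong) (auto simp: algebra_simps)
    also have "\<dots> = (if i = j then 1 else 0) + ((1 - a $ i) * b $ i + a $ i) * w $ j"
      by (simp only: sum.distrib sum.delta' sum.delta finite UNIV_I if_True disjoint reciprocal
          redrawn_stays) (simp add: algebra_simps)
    also have "(1 - a $ i) * b $ i + a $ i = 0"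
      using reciprocal[of i] by (simp add: algebra_simps)
    finally show ?thesis by simp
  qed
  then show ?thesis
    by (simp add: stay_or_redraw_def matrix_matrix_mult_def mat_def vec_eq_iff)
qed

definition deficit :: "real ^ 'n \<Rightarrow> real ^ 'n \<Rightarrow> real ^ 'n" where
  "deficit p q = (\<chi> i. pos_part (1 - p $ i / q $ i))"

definition inverse_deficit :: "real ^ 'n \<Rightarrow> real ^ 'n \<Rightarrow> real ^ 'n" where
  "inverse_deficit p q = (\<chi> i. neg_part (1 - q $ i / p $ i))"

definition excess_distribution :: "real ^ 'n \<Rightarrow> real ^ 'n \<Rightarrow> real ^ 'n" where
  "excess_distribution p q =
     (\<chi> j. pos_part (p $ j - q $ j) / (\<Sum>k\<in>UNIV. pos_part (p $ k - q $ k)))"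

lemma deficit_excess_disjoint:
  assumes "vec_positive q"
  shows "deficit p q $ i * excess_distribution p q $ i = 0"
  using assms
  by (auto simp: deficit_def excess_distribution_def vec_positive_def pos_part_def max_def field_simps)

lemma inverse_deficit_excess_disjoint:
  assumes "vec_positive p"
  shows "inverse_deficit p q $ i * excess_distribution p q $ i = 0"
  using assms
  by (auto simp: inverse_deficit_def excess_distribution_def vec_positive_def pos_part_def
      neg_part_def max_def min_def field_simps)

lemma deficit_reciprocal:
  assumes "vec_positive p" and "vec_positive q"
  shows "(1 - deficit p q $ i) * (1 - inverse_deficit p q $ i) = 1"
proof -
  have "0 < p $ i" "0 < q $ i"
    using assms by (auto simp: vec_positive_def)
  then show ?thesis
    by (auto simp: deficit_def inverse_deficit_def pos_part_def neg_part_def max_def min_def field_simps)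
qed

text \<open>
  The case distinctions in the two matrices are absorbed by the common form. On the diagonal the
  rank-one term vanishes by disjointness of supports. For \<open>p = q\<close> the quotient by the zero sum
  makes \<open>w = 0\<close>, so that the off-diagonal entries are \<open>0\<close>.
\<close>
lemma U_bar_eq_stay_or_redraw:
  assumes "vec_positive q"
  shows "U_bar p q = stay_or_redraw (deficit p q) (excess_distribution p q)"
proof -
  have "U_bar p q $ i $ j = stay_or_redraw (deficit p q) (excess_distribution p q) $ i $ j" for i j
  proof (cases "i = j")
    case True
    then show ?thesis
      using deficit_excess_disjoint[OF assms]
      by (simp add: U_bar_def stay_or_redraw_def) (simp add: deficit_def)
  next
    case False
    then show ?thesis
      by (auto simp: U_bar_def stay_or_redraw_def deficit_def excess_distribution_def pos_part_def)
  qed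
  then show ?thesis
    by (simp add: vec_eq_iff)
qed

lemma V_bar_eq_stay_or_redraw:
  assumes "vec_positive p"
  shows "V_bar p q = stay_or_redraw (inverse_deficit p q) (excess_distribution p q)"
proof -
  have "V_bar p q $ i $ j = stay_or_redraw (inverse_deficit p q) (excess_distribution p q) $ i $ j" for i j
  proof (cases "i = j")
    case True
    then show ?thesis
      using inverse_deficit_excess_disjoint[OF assms]
      by (simp add: V_bar_def stay_or_redraw_def) (simp add: inverse_deficit_def)
  next
    case False
    then show ?thesis
      by (auto simp: V_bar_def stay_or_redraw_def inverse_deficit_def excess_distribution_def pos_part_def)
  qed
  then show ?thesis
    by (simp add: vec_eq_iff)
qed

theorem theorem9:
  fixes p q :: "real ^ 'n"
  assumes "stochastic p" and "stochastic q"
    and "vec_positive p" and "vec_positive q"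
  shows "U_bar p q ** V_bar p q = mat 1"
  unfolding U_bar_eq_stay_or_redraw[OF assms(4)] V_bar_eq_stay_or_redraw[OF assms(3)]
  by (intro stay_or_redraw_inverse deficit_reciprocal inverse_deficit_excess_disjoint assms)

end
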